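(* Let $\Gamma=(V,E)$ be an antipodal association scheme graph with diameter $d\ge1$, let $o\in V$ be any vertex and $o'$ its antipode. Then $\Gamma$ is a reflective antipodal invariant stratification graph with respect to $o$; consequently there exist a real polynomial $f$ and a time $t^*>0$ such that in the state $e^{-if(A)t^*}|o\rangle$, where $A$ is the adjacency matrix of $\Gamma$, the qubits at $o$ and $o'$ are maximally entangled, i.e. their entanglement is $C=1$.
   Context: Graphs are finite, simple and connected; $\partial(x,y)$ is the graph distance. A graph is an association scheme graph if for all $i,j$ the number $|\{z\in V:\partial(x,z)=i,\ \partial(z,y)=j\}|$ depends on the vertices $x,y$ only through $\partial(x,y)$. The one-particle space is $K=\mathbb{C}^V$ with orthonormal basis $|k\rangle$, $k\in V$ (the state with the qubit at $k$ up and all others down), and the adjacency matrix $A$ acts on it. For a reference vertex $o$, the strata are $V_i=\{y\in V:\partial(o,y)=i\}$, $0\le i\le d$, where $d$ is the largest distance from $o$; $n_i=|V_i|$; the stratum states are $|\phi_i\rangle=\frac{1}{\sqrt{n_i}}\sum_{k\in V_i}|k\rangle$. $\Gamma$ is an invariant stratification graph (I.S.G.) with respect to $o$ if $\mathrm{span}\{|\phi_0\rangle,\dots,|\phi_d\rangle\}$ is invariant under $A$. In that case there are Szegő–Jacobi coefficients $\omega_1,\dots,\omega_d>0$ and $\alpha_0,\dots,\alpha_d$ with $A|\phi_i\rangle=\sqrt{\omega_{i+1}}|\phi_{i+1}\rangle+\alpha_i|\phi_i\rangle+\sqrt{\omega_i}|\phi_{i-1}\rangle$ for $0\le i\le d$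 (the terms with $|\phi_{-1}\rangle$, $|\phi_{d+1}\rangle$ being absent). A graph stratified around $o$ is antipodal if the last stratum is a single vertex, $V_d=\{o'\}$; $o'$ is the antipode of $o$. (For an association scheme graph $d$ and $n_d$ do not depend on $o$.) An antipodal I.S.G. is also an I.S.G. with respect to $o'$; let $\omega_i',\alpha_i'$ be the Szegő–Jacobi coefficients for the stratification around $o'$. The antipodal I.S.G. is called reflective if $\omega_i'=\omega_i$ ($1\le i\le d$) and $\alpha_i'=\alpha_i$ ($0\le i\le d$). In a one-particle state $\sum_k\upsilon_k|k\rangle$ the entanglement (concurrence) between the qubits at distinct vertices $m,n$ is $C_{mn}=2|\upsilon_m\upsilon_n|$. *)

theory Defs
  imports "HOL-Analysis.Analysis" "HOL-Computational_Algebra.Polynomial"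
begin

section \<open>Graphs\<close>

text \<open>The vertex set is the whole of a finite type; a graph is given by its edge relation.\<close>

definition simple_connected_graph :: "('v \<Rightarrow> 'v \<Rightarrow> bool) \<Rightarrow> bool" where
  "simple_connected_graph E \<longleftrightarrow> symp E \<and> irreflp E \<and> (\<forall>x y. E\<^sup>*\<^sup>* x y)"

definition gdist :: "('v \<Rightarrow> 'v \<Rightarrow> bool) \<Rightarrow> 'v \<Rightarrow> 'v \<Rightarrow> nat" where
  "gdist E x y = (LEAST n. (E ^^ n) x y)"

definition graph_diameter :: "('v::finite \<Rightarrow> 'v \<Rightarrow> bool) \<Rightarrow> nat" where
  "graph_diameter E = Max {gdist E x y | x y. True}"

definition association_scheme_graph :: "('v::finite \<Rightarrow> 'v \<Rightarrow> bool) \<Rightarrow> bool" where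
  "association_scheme_graph E \<longleftrightarrow> simple_connected_graph E \<and>
     (\<forall>i j x y x' y'. gdist E x y = gdist E x' y' \<longrightarrow>
        card {z. gdist E x z = i \<and> gdist E z y = j} =
        card {z. gdist E x' z = i \<and> gdist E z y' = j})"

definition stratum :: "('v::finite \<Rightarrow> 'v \<Rightarrow> bool) \<Rightarrow> 'v \<Rightarrow> nat \<Rightarrow> 'v set" where
  "stratum E r i = {y. gdist E r y = i}"

definition depth :: "('v::finite \<Rightarrow> 'v \<Rightarrow> bool) \<Rightarrow> 'v \<Rightarrow> nat" where
  "depth E r = Max (range (gdist E r))"

definition antipodal_wrt :: "('v::finite \<Rightarrow> 'v \<Rightarrow> bool) \<Rightarrow> 'v \<Rightarrow> bool" where
  "antipodal_wrt E r \<longleftrightarrow> (\<exists>r'. stratum E r (depth E r) = {r'})"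

text \<open>Only meaningful if \<^term>\<open>antipodal_wrt E r\<close> holds.\<close>
definition antipode :: "('v::finite \<Rightarrow> 'v \<Rightarrow> bool) \<Rightarrow> 'v \<Rightarrow> 'v" where
  "antipode E r = the_elem (stratum E r (depth E r))"

text \<open>In an association scheme graph neither the depth nor the size of the last stratum
  depends on the reference vertex, so one antipodal reference vertex makes all of them
  antipodal.\<close>
definition antipodal_association_scheme_graph :: "('v::finite \<Rightarrow> 'v \<Rightarrow> bool) \<Rightarrow> bool" where
  "antipodal_association_scheme_graph E \<longleftrightarrow>
     association_scheme_graph E \<and> (\<exists>r. antipodal_wrt E r)"

section \<open>The one-particle space and invariant stratification\<close>

definition ket :: "'v::finite \<Rightarrow> complex ^ 'v" where
  "ket k = axis k 1"

definition adjacency_matrix :: "('v::finite \<Rightarrow> 'v \<Rightarrow> bool) \<Rightarrow> complex ^ 'v ^ 'v" where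
  "adjacency_matrix E = (\<chi> x y. if E x y then 1 else 0)"

definition stratum_state :: "('v::finite \<Rightarrow> 'v \<Rightarrow> bool) \<Rightarrow> 'v \<Rightarrow> nat \<Rightarrow> complex ^ 'v" where
  "stratum_state E r i = (1 / sqrt (card (stratum E r i))) *\<^sub>R (\<Sum>k\<in>stratum E r i. ket k)"

text \<open>\<^const>\<open>vec.span\<close> is the complex linear span; the unqualified one would be real.\<close>
definition invariant_stratification_graph :: "('v::finite \<Rightarrow> 'v \<Rightarrow> bool) \<Rightarrow> 'v \<Rightarrow> bool" where
  "invariant_stratification_graph E r \<longleftrightarrow>
     (\<forall>v \<in> vec.span (stratum_state E r ` {..depth E r}).
        adjacency_matrix E *v v \<in> vec.span (stratum_state E r ` {..depth E r}))"

definition szego_jacobi ::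
    "('v::finite \<Rightarrow> 'v \<Rightarrow> bool) \<Rightarrow> 'v \<Rightarrow> (nat \<Rightarrow> real) \<Rightarrow> (nat \<Rightarrow> real) \<Rightarrow> bool" where
  "szego_jacobi E r \<omega> \<alpha> \<longleftrightarrow>
     (\<forall>i\<in>{1..depth E r}. \<omega> i > 0) \<and>
     (\<forall>i\<le>depth E r.
        adjacency_matrix E *v stratum_state E r i =
          (if i < depth E r then sqrt (\<omega> (i + 1)) *\<^sub>R stratum_state E r (i + 1) else 0)
          + \<alpha> i *\<^sub>R stratum_state E r i
          + (if 0 < i then sqrt (\<omega> i) *\<^sub>R stratum_state E r (i - 1) else 0))"

lemma stratum_nonempty:
  assumes "simple_connected_graph E" "i \<le> depth E r"
  shows "stratum E r i \<noteq> {}"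
proof -
  have walk: "(E ^^ gdist E r y) r y" for y
  proof -
    have "E\<^sup>*\<^sup>* r y" using assms(1) by (simp add: simple_connected_graph_def)
    then obtain n where "(E ^^ n) r y" by (auto simp: rtranclp_power)
    then show ?thesis unfolding gdist_def by (rule LeastI)
  qed
  have le: "gdist E r y \<le> n" if "(E ^^ n) r y" for y n
    using that unfolding gdist_def by (rule Least_le)
  have "depth E r \<in> range (gdist E r)" unfolding depth_def by (rule Max_in) auto
  then obtain y where y: "gdist E r y = depth E r" by auto
  define d where "d = depth E r"
  have "(E ^^ (i + (d - i))) r y" using walk[of y] y assms(2) by (simp add: d_def)
  then obtain z where z: "(E ^^ i) r z" "(E ^^ (d - i)) z y"
    by (auto simp: relpowp_add)
  have "(E ^^ (gdist E r z + (d - i))) r y" using walk[of z] z(2)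
    by (auto simp: relpowp_add)
  then have "d \<le> gdist E r z + (d - i)" using le y d_def by metis
  then have "gdist E r z = i" using le[OF z(1)] assms(2) by (simp add: d_def)
  then show ?thesis by (auto simp: stratum_def)
qed

lemma stratum_state_nth:
  "stratum_state E r i $ y = (if gdist E r y = i then of_real (1 / sqrt (card (stratum E r i))) else 0)"
  by (auto simp: stratum_state_def ket_def axis_def stratum_def scaleR_conv_of_real[where 'a=complex])

lemma szego_jacobi_unique:
  assumes G: "simple_connected_graph E"
    and 1: "szego_jacobi E r \<omega> \<alpha>" and 2: "szego_jacobi E r \<omega>' \<alpha>'"
  shows "\<forall>i\<in>{1..depth E r}. \<omega>' i = \<omega> i" and "\<forall>i\<le>depth E r. \<alpha>' i = \<alpha> i"
proof -
  have card0: "card (stratum E r i) \<noteq> 0" if "i \<le> depth E r" for i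
    using stratum_nonempty[OF G that] by simp
  show "\<forall>i\<le>depth E r. \<alpha>' i = \<alpha> i"
  proof (intro allI impI)
    fix i assume i: "i \<le> depth E r"
    obtain y where y: "gdist E r y = i"
      using stratum_nonempty[OF G i] by (auto simp: stratum_def)
    have *: "(adjacency_matrix E *v stratum_state E r i) $ y = of_real (a i / sqrt (card (stratum E r i)))"
      if "szego_jacobi E r w a" for w a
      using that i y unfolding szego_jacobi_def by (auto simp: stratum_state_nth scaleR_conv_of_real[where 'a=complex])
    have "complex_of_real (\<alpha>' i / sqrt (card (stratum E r i))) = of_real (\<alpha> i / sqrt (card (stratum E r i)))"
      using *[OF 1] *[OF 2] by metis
    then show "\<alpha>' i = \<alpha> i" using card0[OF i] unfolding of_real_eq_iff by simp
  qed
  show "\<forall>i\<in>{1..depth E r}. \<omega>' i = \<omega> i"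
  proof
    fix j assume j: "j \<in> {1..depth E r}"
    then obtain i where i: "j = i + 1" "i < depth E r" by (cases j) auto
    obtain y where y: "gdist E r y = j"
      using stratum_nonempty[OF G, of j r] j by (auto simp: stratum_def)
    have *: "(adjacency_matrix E *v stratum_state E r i) $ y = of_real (sqrt (w j) / sqrt (card (stratum E r j)))"
      if "szego_jacobi E r w a" for w a
      using that i y unfolding szego_jacobi_def by (simp add: stratum_state_nth scaleR_conv_of_real[where 'a=complex])
    have "complex_of_real (sqrt (\<omega>' j) / sqrt (card (stratum E r j))) = of_real (sqrt (\<omega> j) / sqrt (card (stratum E r j)))"
      using *[OF 1] *[OF 2] by metis
    then show "\<omega>' j = \<omega> j" using card0[of j] j unfolding of_real_eq_iff by simp
  qed
qed

text \<open>By uniqueness (\<open>szego_jacobi_unique\<close>) the existential quantifier below is harmless: the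
  coefficients are determined on the relevant index ranges.\<close>
definition reflective_antipodal_isg :: "('v::finite \<Rightarrow> 'v \<Rightarrow> bool) \<Rightarrow> 'v \<Rightarrow> bool" where
  "reflective_antipodal_isg E r \<longleftrightarrow>
     invariant_stratification_graph E r \<and> antipodal_wrt E r \<and>
     (\<exists>\<omega> \<alpha> \<omega>' \<alpha>'. szego_jacobi E r \<omega> \<alpha> \<and> szego_jacobi E (antipode E r) \<omega>' \<alpha>' \<and>
        (\<forall>i\<in>{1..depth E r}. \<omega>' i = \<omega> i) \<and> (\<forall>i\<le>depth E r. \<alpha>' i = \<alpha> i))"

section \<open>Time evolution and entanglement\<close>

text \<open>The library multiplication on \<^typ>\<open>complex ^ 'v ^ 'v\<close> is entrywise, hence
  the separate matrix power, matrix polynomial and matrix exponential.\<close>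

primrec matrix_power :: "complex ^ 'v ^ 'v \<Rightarrow> nat \<Rightarrow> complex ^ 'v ^ 'v" where
  "matrix_power M 0 = mat 1"
| "matrix_power M (Suc n) = M ** matrix_power M n"

definition matrix_poly :: "real poly \<Rightarrow> complex ^ 'v ^ 'v \<Rightarrow> complex ^ 'v ^ 'v" where
  "matrix_poly f M = (\<Sum>i\<le>degree f. coeff f i *\<^sub>R matrix_power M i)"

definition matrix_exp :: "complex ^ 'v ^ 'v \<Rightarrow> complex ^ 'v ^ 'v" where
  "matrix_exp M = (\<Sum>n. (1 / fact n) *\<^sub>R matrix_power M n)"

definition evolution :: "complex ^ 'v ^ 'v \<Rightarrow> real \<Rightarrow> complex ^ 'v ^ 'v" where
  "evolution H t = matrix_exp (\<chi> x y. - \<i> * of_real t * H $ x $ y)"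

definition concurrence :: "complex ^ 'v \<Rightarrow> 'v \<Rightarrow> 'v \<Rightarrow> real" where
  "concurrence v m n = 2 * cmod (v $ m * v $ n)"

end

theory Submission
  imports Defs
begin

text \<open>
  All intersection numbers, hence depth, stratum sizes and Szego-Jacobi coefficients, are the same
  for every reference vertex; in terms of intersection numbers they are
  \<open>\<omega>\<^sub>j = p\<^sup>j\<^sub>1\<^sub>,\<^sub>j\<^sub>-\<^sub>1 p\<^sup>j\<^sup>-\<^sup>1\<^sub>1\<^sub>,\<^sub>j\<close> and \<open>\<alpha>\<^sub>i = p\<^sup>i\<^sub>1\<^sub>,\<^sub>i\<close>.
  For the entanglement, the three-term recurrence for the distance matrices shows that each of them
  is a real polynomial in the adjacency matrix. If the last stratum is a single vertex, the last
  distance matrix \<open>S\<close> is an involution, so \<open>exp (-i t S) = cos t - i (sin t) S\<close>, and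
  \<open>t = \<pi>/4\<close> gives both \<open>o\<close> and \<open>o'\<close> an amplitude of modulus \<open>1/\<surd>2\<close>.
\<close>

section \<open>Graph distance\<close>

lemma gdist_walk:
  assumes "simple_connected_graph E"
  shows "(E ^^ gdist E x y) x y"
proof -
  have "E\<^sup>*\<^sup>* x y" using assms by (simp add: simple_connected_graph_def)
  then obtain n where "(E ^^ n) x y" by (auto simp: rtranclp_power)
  then show ?thesis unfolding gdist_def by (rule LeastI)
qed

lemma gdist_le: "(E ^^ n) x y \<Longrightarrow> gdist E x y \<le> n"
  unfolding gdist_def by (rule Least_le)

lemma gdist_eq_0_iff:
  assumes "simple_connected_graph E"
  shows "gdist E x y = 0 \<longleftrightarrow> x = y"
  using gdist_walk[OF assms, of x y] gdist_le[of 0 E x x] by auto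

lemma gdist_eq_1_iff:
  assumes "simple_connected_graph E"
  shows "gdist E x y = 1 \<longleftrightarrow> E x y"
proof
  assume "gdist E x y = 1"
  then show "E x y" using gdist_walk[OF assms, of x y] by (auto simp: OO_def)
next
  assume e: "E x y"
  then have "x \<noteq> y" using assms by (auto simp: simple_connected_graph_def irreflp_def)
  moreover have "gdist E x y \<le> 1" using e by (intro gdist_le) (auto simp: OO_def)
  ultimately show "gdist E x y = 1"
    using gdist_eq_0_iff[OF assms, of x y] by linarith
qed

lemma relpowp_symp: "symp E \<Longrightarrow> (E ^^ n) x y \<Longrightarrow> (E ^^ n) y x"
proof (induction n arbitrary: y)
  case (Suc n)
  then obtain z where "(E ^^ n) x z" "E z y" by auto
  then have "(E ^^ n) z x" "E y z" using Suc.IH[OF Suc.prems(1)] sympD[OF Suc.prems(1)] by blast+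
  then show ?case by (meson relpowp_Suc_I2)
qed auto

lemma gdist_commute:
  assumes "simple_connected_graph E"
  shows "gdist E x y = gdist E y x"
proof -
  have "symp E" using assms by (simp add: simple_connected_graph_def)
  then have "(\<lambda>n. (E ^^ n) x y) = (\<lambda>n. (E ^^ n) y x)"
    using relpowp_symp[of E _ x y] relpowp_symp[of E _ y x] by (intro ext iffI)
  then show ?thesis unfolding gdist_def by (rule arg_cong)
qed

lemma gdist_edge_le:
  assumes G: "simple_connected_graph E" and "E x z"
  shows "gdist E x y \<le> Suc (gdist E z y)" "gdist E z y \<le> Suc (gdist E x y)"
proof -
  have "E z x" using assms sympD unfolding simple_connected_graph_def by metis
  then show "gdist E z y \<le> Suc (gdist E x y)"
    using gdist_walk[OF G, of x y] by (intro gdist_le relpowp_Suc_I2)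
  show "gdist E x y \<le> Suc (gdist E z y)"
    using gdist_walk[OF G, of z y] \<open>E x z\<close> by (intro gdist_le relpowp_Suc_I2)
qed

text \<open>Take the first step of a shortest walk: the rest has length \<open>i\<close>, and a
  shorter walk from \<open>z\<close> would bring \<open>x\<close> closer to
  \<open>y\<close>.\<close>

lemma gdist_Suc_neighbour:
  assumes G: "simple_connected_graph E" and "gdist E x y = Suc i"
  obtains z where "E x z" "gdist E z y = i"
proof -
  have "(E ^^ Suc i) x y" using gdist_walk[OF G, of x y] assms(2) by simp
  then obtain z where z: "E x z" "(E ^^ i) z y" by (meson relpowp_Suc_D2)
  then have "gdist E z y = i"
    using gdist_le[OF z(2)] gdist_edge_le(1)[OF G z(1), of y] assms(2) by simp
  then show thesis using that z(1) by blast
qed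

lemma gdist_le_depth: "gdist E r y \<le> depth E r"
  for E :: "'v::finite \<Rightarrow> 'v \<Rightarrow> bool"
  unfolding depth_def by (intro Max_ge) auto

lemma stratum_antipode: "antipodal_wrt E r \<Longrightarrow> stratum E r (depth E r) = {antipode E r}"
  unfolding antipodal_wrt_def antipode_def by (metis the_elem_eq)

text \<open>Here the diameter hypothesis excludes the one-vertex graph, in which a vertex would be
  its own antipode.\<close>

lemma depth_pos:
  fixes E :: "'v::finite \<Rightarrow> 'v \<Rightarrow> bool"
  assumes G: "simple_connected_graph E" and "graph_diameter E \<ge> 1"
  shows "depth E r > 0"
proof (rule ccontr)
  assume "\<not> depth E r > 0"
  then have "r = y" for y
    using gdist_le_depth[of E r y] gdist_eq_0_iff[OF G, of r y] by simp
  then have "x = y" for x y :: 'v by metis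
  then have "gdist E x y = 0" for x y using gdist_eq_0_iff[OF G, of x y] by blast
  then have "{gdist E x y | x y. True} = {0}" by auto
  then show False using assms(2) by (simp add: graph_diameter_def)
qed

section \<open>Polynomials and exponentials of matrices\<close>

lemma matrix_poly_0 [simp]: "matrix_poly 0 M = 0"
  by (simp add: matrix_poly_def)

lemma matrix_mult_scaleR_right: "A ** (c *\<^sub>R B) = c *\<^sub>R (A ** B)"
  for A B :: "complex ^ 'n ^ 'n"
  by (simp add: matrix_matrix_mult_def vec_eq_iff scaleR_sum_right)

lemma matrix_mult_sum_right: "A ** (\<Sum>i\<in>I. B i) = (\<Sum>i\<in>I. A ** B i)"
  for A :: "complex ^ 'n ^ 'n"
  by (induction I rule: infinite_finite_induct)
    (simp_all add: matrix_add_ldistrib)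

text \<open>Allows a common summation bound, since leading terms of a sum of polynomials may
  cancel.\<close>

lemma matrix_poly_eq_sum:
  assumes "degree f \<le> n"
  shows "matrix_poly f M = (\<Sum>i\<le>n. coeff f i *\<^sub>R matrix_power M i)"
  unfolding matrix_poly_def using assms
  by (intro sum.mono_neutral_left) (auto simp: coeff_eq_0)

lemma matrix_poly_add: "matrix_poly (f + g) M = matrix_poly f M + matrix_poly g M"
  using degree_add_le_max[of f g]
  by (simp add: matrix_poly_eq_sum[where n = "max (degree f) (degree g)"]
      scaleR_add_left sum.distrib)

lemma matrix_poly_smult: "matrix_poly (smult c f) M = c *\<^sub>R matrix_poly f M"
  by (simp add: matrix_poly_eq_sum[where n = "degree f"] scaleR_sum_right degree_smult_le)

text \<open>Horner step: multiplying by the variable becomes left multiplication by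
  \<open>M\<close>, the form in which products occur in the recurrence for distance
  matrices.\<close>

lemma matrix_poly_pCons: "matrix_poly (pCons a f) M = a *\<^sub>R mat 1 + M ** matrix_poly f M"
proof -
  have "matrix_poly (pCons a f) M
      = (\<Sum>i\<le>Suc (degree f). coeff (pCons a f) i *\<^sub>R matrix_power M i)"
    by (intro matrix_poly_eq_sum degree_pCons_le)
  then show ?thesis
    by (subst (asm) sum.atMost_Suc_shift)
      (simp add: matrix_poly_def matrix_mult_sum_right matrix_mult_scaleR_right)
qed

section \<open>Powers and exponential of a scaled involution\<close>

lemma matrix_power_involution:
  fixes S :: "complex ^ 'n::finite ^ 'n"
  assumes "S ** S = mat 1"
  shows "matrix_power (\<chi> x y. z * S $ x $ y) n
    = (\<chi> x y. z ^ n * (if even n then mat 1 else S) $ x $ y)"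
proof (induction n)
  case (Suc n)
  have "(\<chi> x y. z * S $ x $ y) ** (\<chi> x y. z ^ n * B $ x $ y)
      = (\<chi> x y. z ^ Suc n * (S ** B) $ x $ y)" for B :: "complex ^ 'n ^ 'n"
    by (simp add: matrix_matrix_mult_def vec_eq_iff sum_distrib_left mult_ac)
  then show ?case using Suc assms by simp
qed (simp add: vec_eq_iff)

text \<open>\<open>S\<close> has the spectral projections \<open>(1 \<plusminus> S) / 2\<close>.\<close>
lemma matrix_exp_involution:
  fixes S :: "complex ^ 'n::finite ^ 'n"
  assumes "S ** S = mat 1"
  shows "matrix_exp (\<chi> x y. z * S $ x $ y) =
    (\<chi> x y. (exp z + exp (- z)) / 2 * mat 1 $ x $ y + (exp z - exp (- z)) / 2 * S $ x $ y)"
proof -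
  let ?M = "\<chi> x y. z * S $ x $ y"
  let ?c = "\<lambda>x y. (mat 1 $ x $ y + S $ x $ y) / 2"
  let ?d = "\<lambda>x y. (mat 1 $ x $ y - S $ x $ y) / 2"
  \<comment> \<open>By parity of \<open>n\<close>, adding the two terms leaves only the identity
    part or only the \<open>S\<close> part; each term belongs to a scalar exponential
    series.\<close>
  have entry: "((1 / fact n) *\<^sub>R matrix_power ?M n) $ x $ y
      = z ^ n /\<^sub>R fact n * ?c x y + (- z) ^ n /\<^sub>R fact n * ?d x y" for n x y
    unfolding matrix_power_involution[OF assms]
    by (cases "even n") (simp_all add: scaleR_conv_of_real[where 'a = complex] field_simps)
  have "(\<lambda>n. ((1 / fact n) *\<^sub>R matrix_power ?M n) $ x $ y)
      sums (exp z * ?c x y + exp (- z) * ?d x y)" for x y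
    unfolding entry by (intro sums_add sums_mult2 exp_converges)
  then have "(\<lambda>n. (1 / fact n) *\<^sub>R matrix_power ?M n)
      sums (\<chi> x y. exp z * ?c x y + exp (- z) * ?d x y)"
    unfolding sums_def by (intro vec_tendstoI) (simp add: sum_component)
  then show ?thesis
    unfolding matrix_exp_def by (simp add: sums_unique[symmetric] vec_eq_iff field_simps)
qed

lemma evolution_involution:
  fixes S :: "complex ^ 'n::finite ^ 'n"
  assumes "S ** S = mat 1"
  shows "evolution S t $ x $ y
    = of_real (cos t) * mat 1 $ x $ y - \<i> * of_real (sin t) * S $ x $ y"
proof -
  have "(exp (- \<i> * of_real t) + exp (- (- \<i> * of_real t))) / 2 = of_real (cos t)"
    "(exp (- \<i> * of_real t) - exp (- (- \<i> * of_real t))) / 2 = - \<i> * of_real (sin t)"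
    by (simp_all add: cos_of_real[symmetric] sin_of_real[symmetric] cos_exp_eq sin_exp_eq
        field_simps)
  then show ?thesis
    unfolding evolution_def matrix_exp_involution[OF assms] by simp
qed

lemma matrix_vector_mult_ket: "(M *v ket k) $ x = M $ x $ k"
proof -
  have "M $ x $ y * axis k 1 $ y = (if y = k then M $ x $ y else 0)" for y
    by (simp add: axis_def)
  then show ?thesis by (simp add: ket_def matrix_vector_mult_def)
qed

lemma concurrence_evolution_involution:
  fixes S :: "complex ^ 'v::finite ^ 'v"
  assumes "S ** S = mat 1" "m \<noteq> n" "S $ m $ m = 0" "S $ n $ m = 1"
  shows "concurrence (evolution S (pi / 4) *v ket m) m n = 1"
proof -
  have "(evolution S (pi / 4) *v ket m) $ m = of_real (sqrt 2 / 2)"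
    "(evolution S (pi / 4) *v ket m) $ n = - \<i> * of_real (sqrt 2 / 2)"
    unfolding matrix_vector_mult_ket evolution_involution[OF assms(1)] assms(3,4) cos_45 sin_45
    using assms(2) by (simp_all add: mat_def)
  then show ?thesis unfolding concurrence_def by (simp only: norm_mult norm_of_real) simp
qed

section \<open>Szego-Jacobi coefficients and the invariant subspace\<close>

lemma szego_jacobi_imp_invariant:
  assumes "szego_jacobi E r \<omega> \<alpha>"
  shows "invariant_stratification_graph E r"
proof -
  define U where "U = vec.span (stratum_state E r ` {..depth E r})"
  \<comment> \<open>The recurrence scales by reals, whereas \<open>U\<close> is a complex
    span.\<close>
  have scale: "c *\<^sub>R v \<in> U" if "v \<in> U" for c v
  proof -
    have "c *\<^sub>R v = of_real c *s v" by (simp add: vec_eq_iff scaleR_conv_of_real[where 'a = complex])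
    then show ?thesis using that by (simp add: U_def vec.span_scale)
  qed
  have base: "adjacency_matrix E *v stratum_state E r i \<in> U" if "i \<le> depth E r" for i
  proof -
    have "stratum_state E r j \<in> U" if "j \<le> depth E r" for j
      using that unfolding U_def by (intro vec.span_base) auto
    then show ?thesis
      using assms that unfolding szego_jacobi_def
      by (auto intro!: scale vec.span_add[of _ "stratum_state E r ` {..depth E r}", folded U_def]
          vec.span_zero[of "stratum_state E r ` {..depth E r}", folded U_def])
  qed
  have "adjacency_matrix E *v v \<in> U" if "v \<in> U" for v
    using that unfolding U_def
  proof (induction rule: vec.span_induct_alt)
    case (step c x y)
    then show ?case
      using base[unfolded U_def] by (auto simp: matrix_vector_right_distrib vec.scale vector_scalar_commute
          intro!: vec.span_add vec.span_scale)
  qed (simp add: vec.span_zero)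
  then show ?thesis by (simp add: invariant_stratification_graph_def U_def)
qed

section \<open>Association scheme graphs\<close>

text \<open>For an association scheme graph the nonzero ones form the standard basis of its
  Bose-Mesner algebra.\<close>

definition distance_matrix :: "('v::finite \<Rightarrow> 'v \<Rightarrow> bool) \<Rightarrow> nat \<Rightarrow> complex ^ 'v ^ 'v" where
  "distance_matrix E i = (\<chi> x y. if gdist E x y = i then 1 else 0)"

lemma distance_matrix_nth: "distance_matrix E i $ x $ y = (if gdist E x y = i then 1 else 0)"
  by (simp add: distance_matrix_def)

text \<open>Both sides equal \<open>sqrt q * (b / p)\<close>. This turns an edge count between two
  strata into the symmetric off-diagonal coefficient between their normalised states.\<close>

lemma sqrt_balance:
  fixes a b p q :: real
  assumes "p * a = q * b" "p > 0" "q > 0" "b \<ge> 0"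
  shows "a / sqrt q = sqrt (a * b) / sqrt p"
proof -
  have a: "a = q * b / p" using assms by (simp add: field_simps)
  have "a * b / p = q * (b / p)\<^sup>2" by (simp add: a power2_eq_square)
  then have "sqrt (a * b) / sqrt p = sqrt (q * (b / p)\<^sup>2)"
    by (metis real_sqrt_divide)
  also have "\<dots> = sqrt q * (b / p)"
    using assms by (simp add: real_sqrt_mult)
  also have "\<dots> = a / sqrt q"
    using assms by (simp add: a field_simps)
  finally show ?thesis ..
qed

text \<open>Repackages the counting condition as intersection numbers \<open>p i j h\<close>.
  Nothing is assumed about \<open>p i j h\<close> when no two vertices have distance
  \<open>h\<close>.\<close>

locale association_scheme =
  fixes E :: "'v::finite \<Rightarrow> 'v \<Rightarrow> bool" and p :: "nat \<Rightarrow> nat \<Rightarrow> nat \<Rightarrow> nat"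
  assumes graph: "simple_connected_graph E"
    and card_eq_p: "card {z. gdist E x z = i \<and> gdist E z y = j} = p i j (gdist E x y)"
begin

section \<open>Stratum sizes and depth are independent of the reference vertex\<close>

lemma card_stratum: "card (stratum E r i) = p i i 0"
proof -
  have "stratum E r i = {z. gdist E r z = i \<and> gdist E z r = i}"
    by (auto simp: stratum_def gdist_commute[OF graph])
  then show ?thesis using card_eq_p[of r i r i] gdist_eq_0_iff[OF graph, of r r] by simp
qed

lemma p_0_pos: "i \<le> depth E r \<Longrightarrow> p i i 0 > 0"
  using stratum_nonempty[OF graph, of i r] card_stratum[of r i] by (metis card_gt_0_iff finite)

text \<open>The stratum of \<open>y\<close> at level \<open>depth E x\<close> is as large as that of
  \<open>x\<close>, hence nonempty, so \<open>y\<close> is at least as deep; the roles can be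
  exchanged.\<close>

lemma depth_eq: "depth E r = depth E r'"
proof -
  have "depth E x \<le> depth E y" for x y
  proof -
    have "card (stratum E y (depth E x)) > 0"
      using p_0_pos[of "depth E x" x] card_stratum by simp
    then obtain z where "gdist E y z = depth E x"
      by (auto simp: card_gt_0_iff stratum_def)
    then show ?thesis using gdist_le_depth[of E y z] by simp
  qed
  then show ?thesis by (simp add: antisym)
qed

section \<open>Intersection numbers for neighbours\<close>

lemma card_neighbours: "card {z. E x z \<and> gdist E z y = i} = p 1 i (gdist E x y)"
  using card_eq_p[of x 1 y i] unfolding gdist_eq_1_iff[OF graph] .

text \<open>Moving along an edge changes a distance by at most one; this makes the recurrences
  three-term. The pair \<open>x\<close>, \<open>y\<close> ensures that \<open>h\<close> is an actual
  distance.\<close>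

lemma p_1_eq_0:
  assumes "h > Suc i \<or> i > Suc h" "gdist E x y = h"
  shows "p 1 i h = 0"
proof -
  have "{z. E x z \<and> gdist E z y = i} = {}"
    using assms gdist_edge_le[OF graph, of x _ y] by fastforce
  then show ?thesis using card_neighbours[of x y i] assms(2) by (metis card.empty)
qed

lemma p_1_Suc_pos:
  assumes "gdist E x y = Suc i"
  shows "p 1 i (Suc i) > 0"
proof -
  obtain z where "E x z" "gdist E z y = i" using gdist_Suc_neighbour[OF graph assms] .
  then have "card {z. E x z \<and> gdist E z y = i} > 0" by (auto simp: card_gt_0_iff)
  then show ?thesis using card_neighbours[of x y i] assms by simp
qed

text \<open>Both sides count the edges between the strata \<open>h\<close> and \<open>i\<close> of a vertex.\<close>
lemma p_1_balance: "p h h 0 * p 1 i h = p i i 0 * p 1 h i"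
proof -
  fix r :: 'v
  have count: "(\<Sum>x\<in>stratum E r h. \<Sum>z\<in>stratum E r i. if E x z then 1 else 0)
      = p h h 0 * p 1 i h" for h i
  proof -
    have "(\<Sum>z\<in>stratum E r i. if E x z then 1 else 0) = p 1 i h" if "x \<in> stratum E r h" for x
    proof -
      have "(\<Sum>z\<in>stratum E r i. if E x z then 1 else 0) = card {z\<in>stratum E r i. E x z}"
        by (simp add: sum.If_cases Int_def)
      also have "{z\<in>stratum E r i. E x z} = {z. E x z \<and> gdist E z r = i}"
        by (auto simp: stratum_def gdist_commute[OF graph])
      finally show ?thesis
        using that by (simp add: card_neighbours stratum_def gdist_commute[OF graph])
    qed
    then show ?thesis by (simp add: card_stratum)
  qed
  have "E x z \<longleftrightarrow> E z x" for x z
    using graph sympD unfolding simple_connected_graph_def by metis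
  then have "(\<Sum>x\<in>stratum E r h. \<Sum>z\<in>stratum E r i. if E x z then 1 else 0)
      = (\<Sum>z\<in>stratum E r i. \<Sum>x\<in>stratum E r h. if E z x then 1 else 0 :: nat)"
    by (subst sum.swap) simp
  then show ?thesis using count by simp
qed

section \<open>Szego-Jacobi coefficients from intersection numbers\<close>

lemma adjacency_stratum_state_nth:
  "(adjacency_matrix E *v stratum_state E r i) $ y
    = of_real (p 1 i (gdist E r y) / sqrt (p i i 0))"
proof -
  have "(adjacency_matrix E *v stratum_state E r i) $ y
      = (\<Sum>z\<in>UNIV. if E y z \<and> gdist E z r = i then of_real (1 / sqrt (p i i 0)) else 0)"
    unfolding matrix_vector_mult_def adjacency_matrix_def
    by (auto simp: stratum_state_nth card_stratum gdist_commute[OF graph, of r] intro!: sum.cong)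
  also have "\<dots> = of_nat (card {z. E y z \<and> gdist E z r = i}) * of_real (1 / sqrt (p i i 0))"
    by (simp add: sum.If_cases)
  finally show ?thesis by (simp add: card_neighbours gdist_commute[OF graph, of y])
qed

text \<open>The coefficients do not mention \<open>r\<close>, so the same sequences serve the
  antipode; this is what yields reflectivity. The recurrence is checked entrywise, according to the
  distance \<open>h\<close> of the entry from \<open>r\<close>.\<close>

lemma szego_jacobi_intersection_numbers:
  "szego_jacobi E r (\<lambda>j. real (p 1 (j - 1) j) * real (p 1 j (j - 1))) (\<lambda>i. real (p 1 i i))"
    (is "szego_jacobi E r ?\<omega> ?\<alpha>")
  unfolding szego_jacobi_def
proof (intro conjI ballI allI impI)
  fix j assume j: "j \<in> {1..depth E r}"
  then obtain y where y: "gdist E r y = j"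
    using stratum_nonempty[OF graph, of j r] by (auto simp: stratum_def)
  have "p 1 (j - 1) j > 0" using p_1_Suc_pos[of r y "j - 1"] y j by simp
  moreover have "p j j 0 > 0" using p_0_pos[of j r] j by simp
  \<comment> \<open>If it were zero, one side of the balance would vanish while the other is a
    product of positive numbers.\<close>
  ultimately have "p 1 j (j - 1) > 0"
    using p_1_balance[of j "j - 1"] by (metis mult_is_0 neq0_conv)
  then show "?\<omega> j > 0" using \<open>p 1 (j - 1) j > 0\<close> by simp
next
  fix i assume i: "i \<le> depth E r"
  show "adjacency_matrix E *v stratum_state E r i =
      (if i < depth E r then sqrt (?\<omega> (i + 1)) *\<^sub>R stratum_state E r (i + 1) else 0)
      + ?\<alpha> i *\<^sub>R stratum_state E r i
      + (if 0 < i then sqrt (?\<omega> i) *\<^sub>R stratum_state E r (i - 1) else 0)"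
  proof (rule vec_eq_iff[THEN iffD2, rule_format])
    fix y
    define h where "h = gdist E r y"
    have h: "h \<le> depth E r" by (simp add: h_def gdist_le_depth)
    have "real (p h h 0) * real (p 1 i h) = real (p i i 0) * real (p 1 h i)"
      using p_1_balance[of h i] by (metis of_nat_mult)
    \<comment> \<open>For adjacent levels the radicand is the coefficient \<omega> at the larger of
      \<open>h\<close> and \<open>i\<close>, and \<open>sqrt (p h h 0)\<close> normalises the state
      of stratum \<open>h\<close>.\<close>
    then have bal: "p 1 i h / sqrt (p i i 0)
        = sqrt (real (p 1 i h) * real (p 1 h i)) / sqrt (p h h 0)"
      using p_0_pos[OF h] p_0_pos[OF i] by (intro sqrt_balance) auto
    consider "h = Suc i" | "h = i" | "i = Suc h" | "h > Suc i \<or> i > Suc h" by linarith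
    then show "(adjacency_matrix E *v stratum_state E r i) $ y =
      ((if i < depth E r then sqrt (?\<omega> (i + 1)) *\<^sub>R stratum_state E r (i + 1) else 0)
      + ?\<alpha> i *\<^sub>R stratum_state E r i
      + (if 0 < i then sqrt (?\<omega> i) *\<^sub>R stratum_state E r (i - 1) else 0)) $ y"
    proof cases
      case 1
      then show ?thesis
        using h bal unfolding adjacency_stratum_state_nth h_def[symmetric]
        by (simp add: stratum_state_nth h_def[symmetric] card_stratum scaleR_conv_of_real[where 'a = complex]
            flip: of_real_mult of_real_divide)
    next
      case 2
      then show ?thesis
        using h unfolding adjacency_stratum_state_nth h_def[symmetric]
        by (cases i) (simp_all add: stratum_state_nth h_def[symmetric] card_stratum scaleR_conv_of_real[where 'a = complex])
    next
      case 3
      then show ?thesis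
        using h bal unfolding adjacency_stratum_state_nth h_def[symmetric]
        by (simp add: stratum_state_nth h_def[symmetric] card_stratum scaleR_conv_of_real[where 'a = complex] mult.commute
            flip: of_real_mult of_real_divide)
    next
      case 4
      then have "h \<noteq> i + 1" "h \<noteq> i" "0 < i \<Longrightarrow> h \<noteq> i - 1" by auto
      moreover have "p 1 i h = 0" using p_1_eq_0[OF 4 h_def[symmetric]] .
      ultimately show ?thesis
        unfolding adjacency_stratum_state_nth h_def[symmetric]
        by (simp add: stratum_state_nth h_def[symmetric] del: One_nat_def)
    qed
  qed
qed

section \<open>Distance matrices as real polynomials in the adjacency matrix\<close>

lemma adjacency_distance_matrix_nth:
  "(adjacency_matrix E ** distance_matrix E i) $ x $ y = of_nat (p 1 i (gdist E x y))"
proof -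
  have "(adjacency_matrix E ** distance_matrix E i) $ x $ y
      = (\<Sum>z\<in>UNIV. if E x z \<and> gdist E z y = i then 1 else 0)"
    unfolding matrix_matrix_mult_def adjacency_matrix_def distance_matrix_def
    by (auto intro!: sum.cong)
  then show ?thesis by (simp add: sum.If_cases card_neighbours)
qed

text \<open>Left multiplication by the adjacency matrix reaches only the levels
  \<open>i - 1\<close>, \<open>i\<close> and \<open>i + 1\<close>; the expansion is solved for the
  highest one. At \<open>i = 0\<close> there is no lower level, and natural subtraction would give
  \<open>0\<close> again.\<close>

lemma distance_matrix_recurrence:
  "real (p 1 i (Suc i)) *\<^sub>R distance_matrix E (Suc i)
    = adjacency_matrix E ** distance_matrix E i - real (p 1 i i) *\<^sub>R distance_matrix E i
      - (if i = 0 then 0 else real (p 1 i (i - 1)) *\<^sub>R distance_matrix E (i - 1))"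
proof (intro vec_eq_iff[THEN iffD2, rule_format])
  fix x y
  define h where "h = gdist E x y"
  consider "h = Suc i" | "h = i" | "i = Suc h" | "h > Suc i \<or> i > Suc h" by linarith
  then show "(real (p 1 i (Suc i)) *\<^sub>R distance_matrix E (Suc i)) $ x $ y
    = (adjacency_matrix E ** distance_matrix E i - real (p 1 i i) *\<^sub>R distance_matrix E i
      - (if i = 0 then 0 else real (p 1 i (i - 1)) *\<^sub>R distance_matrix E (i - 1))) $ x $ y"
  proof cases
    case 4
    then show ?thesis
      using p_1_eq_0[OF 4 h_def[symmetric]]
      by (auto simp: adjacency_distance_matrix_nth h_def[symmetric] distance_matrix_nth)
  qed (auto simp: adjacency_distance_matrix_nth h_def[symmetric] distance_matrix_nth
      scaleR_conv_of_real[where 'a = complex])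
qed

lemma distance_matrix_polynomial: "\<exists>f. distance_matrix E i = matrix_poly f (adjacency_matrix E)"
proof (induction i rule: less_induct)
  case (less i)
  show ?case
  proof (cases i)
    case 0
    have "distance_matrix E 0 = matrix_poly [:1:] (adjacency_matrix E)"
      by (simp add: matrix_poly_pCons distance_matrix_def mat_def gdist_eq_0_iff[OF graph])
    then show ?thesis using 0 by blast
  next
    case (Suc k)
    show ?thesis
    proof (cases "\<exists>x y. gdist E x y = Suc k")
      \<comment> \<open>Beyond the diameter the matrix is zero, and the leading coefficient of the
        recurrence is not known to be invertible.\<close>
      case False
      then have "distance_matrix E i = matrix_poly 0 (adjacency_matrix E)"
        by (simp add: Suc distance_matrix_def vec_eq_iff)
      then show ?thesis by blast
    next
      case True
      then have c: "p 1 k (Suc k) > 0" using p_1_Suc_pos by auto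
      obtain f where f: "distance_matrix E k = matrix_poly f (adjacency_matrix E)"
        using less[of k] Suc by auto
      obtain g where g: "(if k = 0 then 0 else real (p 1 k (k - 1)) *\<^sub>R distance_matrix E (k - 1))
          = matrix_poly g (adjacency_matrix E)"
      proof (cases "k = 0")
        case False
        then obtain g where "distance_matrix E (k - 1) = matrix_poly g (adjacency_matrix E)"
          using less[of "k - 1"] Suc by (meson diff_le_self le_imp_less_Suc)
        then show thesis using that False by (simp flip: matrix_poly_smult)
      qed (use that[of 0] in simp)
      have "distance_matrix E i
          = (1 / real (p 1 k (Suc k))) *\<^sub>R (real (p 1 k (Suc k)) *\<^sub>R distance_matrix E (Suc k))"
        using c Suc by simp
      \<comment> \<open>\<open>pCons 0 f\<close> is the variable times \<open>f\<close> and accounts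
        for the product with the adjacency matrix; \<open>g\<close> carries the lower term.\<close>
      also have "\<dots> = matrix_poly (smult (1 / real (p 1 k (Suc k)))
          (pCons 0 f + smult (- real (p 1 k k)) f + smult (- 1) g)) (adjacency_matrix E)"
        unfolding distance_matrix_recurrence g f
        by (simp add: matrix_poly_smult matrix_poly_add matrix_poly_pCons
            del: smult_minus_left)
      finally show ?thesis by blast
    qed
  qed
qed

section \<open>The antipodal map\<close>

lemma antipodal_everywhere:
  assumes "antipodal_wrt E s"
  shows "antipodal_wrt E r"
proof -
  have "card (stratum E s (depth E s)) = 1" using stratum_antipode[OF assms] by simp
  then have "card (stratum E r (depth E r)) = 1"
    using depth_eq[of r s] by (simp add: card_stratum)
  then show ?thesis by (auto simp: antipodal_wrt_def card_1_singleton_iff)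
qed

text \<open>The matrix is the permutation matrix of the antipodal map, which is its own inverse
  because distance is symmetric and all depths agree.\<close>

lemma distance_matrix_depth_involution:
  assumes "antipodal_wrt E s"
  shows "distance_matrix E (depth E s) ** distance_matrix E (depth E s) = mat 1"
proof -
  define d where "d = depth E s"
  have anti: "gdist E x y = d \<longleftrightarrow> y = antipode E x" for x y
    using stratum_antipode[OF antipodal_everywhere[OF assms, of x]] depth_eq[of x s]
    by (auto simp: stratum_def d_def)
  have "antipode E (antipode E x) = x" for x
    using anti gdist_commute[OF graph] by metis
  then have "(\<Sum>z\<in>UNIV. (if z = antipode E x then 1 else 0) *
      (if y = antipode E z then 1 else 0)) = (if x = y then 1 else 0 :: complex)" for x y
    by (subst sum.mono_neutral_right[of UNIV "{antipode E x}"]) auto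
  then show ?thesis
    unfolding d_def[symmetric] by (simp add: vec_eq_iff distance_matrix_def matrix_matrix_mult_def anti mat_def)
qed

end

lemma association_scheme_graphE:
  assumes "association_scheme_graph E"
  obtains p where "association_scheme E p"
proof -
  \<comment> \<open>Counts for one chosen pair at distance \<open>h\<close>; the scheme condition
    makes the choice immaterial whenever such a pair exists.\<close>
  define p where "p i j h = (let (x, y) = SOME (x, y). gdist E x y = h
    in card {z. gdist E x z = i \<and> gdist E z y = j})" for i j h
  have "card {z. gdist E x z = i \<and> gdist E z y = j} = p i j (gdist E x y)" for i j x y
  proof -
    obtain x' y' where some: "(SOME (x', y'). gdist E x' y' = gdist E x y) = (x', y')"
      by fastforce
    have "case (x', y') of (x', y') \<Rightarrow> gdist E x' y' = gdist E x y"
      unfolding some[symmetric] by (rule someI[of _ "(x, y)"]) simp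
    then have "gdist E x y = gdist E x' y'" by simp
    then have "card {z. gdist E x z = i \<and> gdist E z y = j}
        = card {z. gdist E x' z = i \<and> gdist E z y' = j}"
      using assms unfolding association_scheme_graph_def by blast
    then show ?thesis unfolding p_def some by simp
  qed
  then have "association_scheme E p"
    using assms by (simp add: association_scheme_graph_def association_scheme_def)
  then show thesis by (rule that)
qed

theorem mainTheorem4:
  fixes E :: "'v::finite \<Rightarrow> 'v \<Rightarrow> bool" and r :: 'v
  assumes "antipodal_association_scheme_graph E"
    and "graph_diameter E \<ge> 1"
  shows "reflective_antipodal_isg E r \<and>
    (\<exists>(f :: real poly) (t :: real). t > 0 \<and>
       concurrence (evolution (matrix_poly f (adjacency_matrix E)) t *v ket r) r (antipode E r) = 1)"
proof -
  obtain s p where s: "antipodal_wrt E s" and "association_scheme E p"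
    using assms(1) association_scheme_graphE
    unfolding antipodal_association_scheme_graph_def by metis
  interpret association_scheme E p by fact
  have r: "antipodal_wrt E r" using antipodal_everywhere[OF s] .
  have "reflective_antipodal_isg E r"
    unfolding reflective_antipodal_isg_def
    using r szego_jacobi_intersection_numbers
      szego_jacobi_imp_invariant[OF szego_jacobi_intersection_numbers] by blast
  moreover have "\<exists>(f :: real poly) t. t > 0 \<and>
    concurrence (evolution (matrix_poly f (adjacency_matrix E)) t *v ket r) r (antipode E r) = 1"
  proof -
    let ?S = "distance_matrix E (depth E r)"
    have "depth E r > 0" using depth_pos[OF graph assms(2)] .
    moreover have d: "gdist E r (antipode E r) = depth E r"
      using stratum_antipode[OF r] by (auto simp: stratum_def)
    moreover have "gdist E r r = 0" by (simp add: gdist_eq_0_iff[OF graph])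
    \<comment> \<open>Positive depth separates \<open>r\<close> from its antipode and clears the
      diagonal entry, so the amplitude left at \<open>r\<close> is the cosine alone.\<close>
    ultimately have "r \<noteq> antipode E r" "?S $ r $ r = 0" "?S $ antipode E r $ r = 1"
      by (auto simp: distance_matrix_def gdist_commute[OF graph, of "antipode E r"])
    then have "concurrence (evolution ?S (pi / 4) *v ket r) r (antipode E r) = 1"
      by (intro concurrence_evolution_involution distance_matrix_depth_involution[OF r])
    moreover obtain f where "?S = matrix_poly f (adjacency_matrix E)"
      using distance_matrix_polynomial by blast
    ultimately show ?thesis by (metis divide_pos_pos pi_gt_zero zero_less_numeral)
  qed
  ultimately show ?thesis ..
qed

end
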